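(* Let $s$ and $t$ be fixed integers with $s> t\ge 2$, and let $n\to\infty$. Then there is a constant $c=c(s,t)>0$, depending only on $s$ and $t$, such that $$f(n,n-s,n-t) \le (1-c) \binom{n}{t}$$ for all sufficiently large $n$.
   Context: A $k$-partition of a finite set $X$ is a partition $\mathcal{P}=(X_1,\dots,X_k)$ of $X$ into precisely $k$ nonempty classes. An $r$-element set $H\subseteq X$ crosses $\mathcal{P}$ if $H$ intersects exactly $\min(r,k)$ of the classes. A hypergraph (set of subsets of $X$) crosses $\mathcal{P}$ if at least one of its members does. For integers $n\ge k$, $n\ge r$, $f(n,k,r)$ denotes the minimum number of edges of an $r$-uniform hypergraph $\mathcal{H}\subseteq\binom{X}{r}$ on an $n$-element set $X$ that crosses every $k$-partition of $X$. Here $k=n-s$ and $r=n-t$. *)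

theory Defs
  imports Complex_Main "HOL-Library.Disjoint_Sets"
begin

definition k_partition :: "nat \<Rightarrow> 'a set \<Rightarrow> 'a set set \<Rightarrow> bool" where
  "k_partition k X P \<longleftrightarrow> partition_on X P \<and> card P = k"

definition edge_crosses :: "'a set \<Rightarrow> 'a set set \<Rightarrow> bool" where
  "edge_crosses E P \<longleftrightarrow> card {C \<in> P. E \<inter> C \<noteq> {}} = min (card E) (card P)"

definition hypergraph_crosses :: "'a set set \<Rightarrow> 'a set set \<Rightarrow> bool" where
  "hypergraph_crosses H P \<longleftrightarrow> (\<exists>E\<in>H. edge_crosses E P)"

definition uniform_hypergraph :: "nat \<Rightarrow> 'a set \<Rightarrow> 'a set set \<Rightarrow> bool" where
  "uniform_hypergraph r X H \<longleftrightarrow> H \<subseteq> {E. E \<subseteq> X \<and> card E = r}"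

text \<open>
  The \<open>n\<close>-element ground set is taken to be \<open>{..<n}\<close>. For \<open>k \<le> n\<close> and \<open>r \<le> n\<close> the minimum
  exists, since the complete \<open>r\<close>-uniform hypergraph crosses every \<open>k\<close>-partition; outside
  this range the value carries no meaning.
\<close>

definition min_crossing_edges :: "nat \<Rightarrow> nat \<Rightarrow> nat \<Rightarrow> nat" where
  "min_crossing_edges n k r =
     (LEAST m. \<exists>H. uniform_hypergraph r {..<n} H \<and>
                   (\<forall>P. k_partition k {..<n} P \<longrightarrow> hypergraph_crosses H P) \<and>
                   card H = m)"

end

theory Submission
  imports Defs "HOL-Library.FuncSet"
begin

text \<open>
  Write the edges as complements \<open>X - T\<close> of \<open>t\<close>-sets. Since \<open>n - s < n - t\<close>, such an edge
  crosses a partition into \<open>n - s\<close> classes as soon as it meets every class, and for this it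
  suffices that it contains a transversal \<open>R\<close> of the partition, that is, that
  \<open>T \<subseteq> X - R\<close>. The set \<open>X - R\<close> has exactly \<open>s\<close> elements.

  Colour \<open>X\<close> with \<open>t\<close> colours. Because \<open>s > t\<close>, two elements of \<open>X - R\<close> share a colour, and
  because \<open>t \<ge> 2\<close> they extend to a \<open>t\<close>-set \<open>T \<subseteq> X - R\<close>, which is not rainbow. So the
  complements of the non-rainbow \<open>t\<close>-sets cross every partition
  (\<open>non_rainbow_complement_crosses\<close>), and the rainbow \<open>t\<close>-sets are saved
  (\<open>min_crossing_edges_plus_rainbow_le\<close>).

  If the colour classes have almost equal sizes, here the residue classes modulo \<open>t\<close>, then
  at least \<open>(n div t) ^ t\<close> of the \<open>t\<close>-sets are rainbow (\<open>card_rainbow_mod_ge\<close>). As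
  \<open>n choose t \<le> n ^ t\<close> and \<open>n div t \<ge> n / (2 * t)\<close> for \<open>n \<ge> t\<close>, this is at least
  the fraction \<open>c = 1 / (2 * t) ^ t\<close> of all \<open>t\<close>-sets.
\<close>

definition rainbow_sets :: "('a \<Rightarrow> 'b) \<Rightarrow> nat \<Rightarrow> 'a set \<Rightarrow> 'a set set" where
  "rainbow_sets f t X = {T. T \<subseteq> X \<and> card T = t \<and> inj_on f T}"

lemma partition_on_obtains_transversal:
  assumes "partition_on X P"
  obtains R where "R \<subseteq> X" "card R = card P" "\<And>C. C \<in> P \<Longrightarrow> R \<inter> C \<noteq> {}"
proof -
  define r where "r C = (SOME x. x \<in> C)" for C :: "'a set"
  have r: "r C \<in> C" if "C \<in> P" for C
    using assms that unfolding r_def partition_on_def by (metis some_in_eq)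
  have "inj_on r P"
  proof (rule inj_onI)
    fix C D assume "C \<in> P" "D \<in> P" "r C = r D"
    then have "r C \<in> C \<inter> D" using r by fastforce
    then show "C = D"
      using assms \<open>C \<in> P\<close> \<open>D \<in> P\<close> unfolding partition_on_def disjoint_def by blast
  qed
  show thesis
  proof (rule that[of "r ` P"])
    show "r ` P \<subseteq> X" using assms r unfolding partition_on_def by blast
    show "card (r ` P) = card P" using \<open>inj_on r P\<close> by (rule card_image)
    show "r ` P \<inter> C \<noteq> {}" if "C \<in> P" for C using r that by blast
  qed
qed

lemma edge_crosses_if_meets_all:
  assumes "\<And>C. C \<in> P \<Longrightarrow> E \<inter> C \<noteq> {}" and "card P \<le> card E"
  shows "edge_crosses E P"
proof -
  have "{C \<in> P. E \<inter> C \<noteq> {}} = P" using assms(1) by blast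
  then show ?thesis using assms(2) by (simp add: edge_crosses_def)
qed

text \<open>
  The complement of a transversal has \<open>s > t\<close> elements, so the pigeonhole principle yields two
  of them with the same colour, and any \<open>t\<close>-set between this pair and the complement works.
\<close>

lemma non_rainbow_complement_crosses:
  fixes f :: "'a \<Rightarrow> 'b"
  assumes X: "finite X" and colours: "card (f ` X) \<le> t"
    and t: "2 \<le> t" "t < s" and s: "s \<le> card X"
    and P: "k_partition (card X - s) X P"
  shows "\<exists>T. T \<subseteq> X \<and> card T = t \<and> \<not> inj_on f T \<and> edge_crosses (X - T) P"
proof -
  have part: "partition_on X P" and cP: "card P = card X - s"
    using P by (auto simp: k_partition_def)
  obtain R where R: "R \<subseteq> X" "card R = card P" "\<And>C. C \<in> P \<Longrightarrow> R \<inter> C \<noteq> {}"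
    using partition_on_obtains_transversal[OF part] by blast
  have cW: "card (X - R) = s"
    using R X cP s by (simp add: card_Diff_subset finite_subset)
  have "card (f ` (X - R)) \<le> card (f ` X)"
    using X by (intro card_mono) auto
  then have "\<not> inj_on f (X - R)"
    using pigeonhole[of f "X - R"] cW colours t by linarith
  then obtain x y where xy: "x \<in> X - R" "y \<in> X - R" "x \<noteq> y" "f x = f y"
    unfolding inj_on_def by blast
  have "\<exists>T. {x, y} \<subseteq> T \<and> T \<subseteq> X - R \<and> card T = t"
    by (rule exists_subset_between) (use xy t cW X in auto)
  then obtain T where T: "{x, y} \<subseteq> T" "T \<subseteq> X - R" "card T = t" by blast
  have "\<not> inj_on f T" using T(1) xy unfolding inj_on_def by blast
  moreover have "edge_crosses (X - T) P"
  proof (rule edge_crosses_if_meets_all)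
    show "(X - T) \<inter> C \<noteq> {}" if "C \<in> P" for C using R T that by blast
    have "card (X - T) = card X - t"
      using T X by (metis card_Diff_subset Diff_subset finite_subset order_trans)
    then show "card P \<le> card (X - T)" using cP t by simp
  qed
  ultimately show ?thesis using T by blast
qed

lemma min_crossing_edges_plus_rainbow_le:
  fixes f :: "nat \<Rightarrow> 'b"
  assumes colours: "card (f ` {..<n}) \<le> t" and t: "2 \<le> t" "t < s" and s: "s \<le> n"
  shows "min_crossing_edges n (n - s) (n - t) + card (rainbow_sets f t {..<n}) \<le> n choose t"
proof -
  define all where "all = {T. T \<subseteq> {..<n} \<and> card T = t}"
  define rb where "rb = rainbow_sets f t {..<n}"
  define H where "H = (\<lambda>T. {..<n} - T) ` (all - rb)"
  have fin: "finite all" by (simp add: all_def)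
  have sub: "rb \<subseteq> all" by (auto simp: rb_def all_def rainbow_sets_def)
  have "uniform_hypergraph (n - t) {..<n} H"
  proof -
    have "card ({..<n} - T) = n - t" if "T \<in> all" for T
      using that by (auto simp: all_def card_Diff_subset finite_subset)
    then show ?thesis by (auto simp: uniform_hypergraph_def H_def)
  qed
  moreover have "hypergraph_crosses H P" if "k_partition (n - s) {..<n} P" for P
  proof -
    have "k_partition (card {..<n} - s) {..<n} P" using that by simp
    moreover have "s \<le> card {..<n}" using s by simp
    ultimately obtain T
      where "T \<subseteq> {..<n}" "card T = t" "\<not> inj_on f T" "edge_crosses ({..<n} - T) P"
      using non_rainbow_complement_crosses[OF finite_lessThan colours t] by blast
    then show ?thesis
      by (auto simp: hypergraph_crosses_def H_def all_def rb_def rainbow_sets_def)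
  qed
  ultimately have "min_crossing_edges n (n - s) (n - t) \<le> card H"
    unfolding min_crossing_edges_def by (intro Least_le) blast
  also have "card H \<le> card (all - rb)"
    unfolding H_def by (rule card_image_le) (use fin in simp)
  finally have "min_crossing_edges n (n - s) (n - t) \<le> card all - card rb"
    using card_Diff_subset[OF finite_subset[OF sub fin] sub] by simp
  moreover have "card rb \<le> card all" using card_mono[OF fin sub] .
  moreover have "card all = n choose t"
    by (simp add: all_def n_subsets)
  ultimately show ?thesis by (simp add: rb_def)
qed

text \<open>
  A choice of quotients \<open>g i < n div t\<close> for the residues \<open>i < t\<close> determines the rainbow set of
  the numbers \<open>i + t * g i\<close>, and can be recovered from it by division with remainder.
\<close>

lemma card_rainbow_mod_ge:
  "(n div t) ^ t \<le> card (rainbow_sets (\<lambda>x. x mod t) t {..<n})"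
proof -
  define G where "G = {..<t} \<rightarrow>\<^sub>E {..<n div t}"
  define S where "S g = (\<lambda>i. i + t * g i) ` {..<t}" for g :: "nat \<Rightarrow> nat"
  have rainbow: "S g \<in> rainbow_sets (\<lambda>x. x mod t) t {..<n}" if "g \<in> G" for g
  proof -
    have "i + t * g i < n" if "i < t" for i
    proof -
      have "Suc (g i) \<le> n div t"
        using \<open>g \<in> G\<close> that by (auto simp: G_def PiE_iff Suc_le_eq)
      then have "t * Suc (g i) \<le> t * (n div t)" by (rule mult_le_mono2)
      also have "\<dots> \<le> n" by simp
      finally show ?thesis using that by simp
    qed
    moreover have "inj_on (\<lambda>x. x mod t) (S g)" by (auto simp: S_def inj_on_def)
    moreover have "card (S g) = t"
    proof -
      have "inj_on (\<lambda>i. i + t * g i) {..<t}"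
        by (rule inj_on_inverseI[where g = "\<lambda>x. x mod t"]) simp
      then show ?thesis by (simp add: S_def card_image)
    qed
    ultimately show ?thesis by (auto simp: rainbow_sets_def S_def)
  qed
  have "inj_on S G"
  proof (rule inj_onI)
    fix g h assume gh: "g \<in> G" "h \<in> G" and eq: "S g = S h"
    show "g = h"
    proof (rule PiE_ext[OF gh[unfolded G_def]])
      fix i assume i: "i \<in> {..<t}"
      then have "i + t * g i \<in> S h" unfolding eq[symmetric] by (auto simp: S_def)
      then obtain j where j: "j < t" "i + t * g i = j + t * h j" by (auto simp: S_def)
      have "i mod t = j mod t" using j(2) by (metis mod_mult_self2)
      then have "i = j" using i j(1) by simp
      then show "g i = h i" using i j by simp
    qed
  qed
  have "finite (rainbow_sets (\<lambda>x. x mod t) t {..<n})"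
    by (rule finite_subset[of _ "Pow {..<n}"]) (auto simp: rainbow_sets_def)
  then have "card G \<le> card (rainbow_sets (\<lambda>x. x mod t) t {..<n})"
    by (intro card_inj_on_le[OF \<open>inj_on S G\<close>]) (use rainbow in auto)
  then show ?thesis by (simp add: G_def card_PiE)
qed

lemma binomial_le_div_power:
  assumes "0 < t" "t \<le> n"
  shows "n choose t \<le> (2 * t) ^ t * (n div t) ^ t"
proof -
  have "1 \<le> n div t" using assms by (simp add: Suc_le_eq div_greater_zero_iff)
  then have "t \<le> t * (n div t)" by simp
  moreover have "n mod t < t" using assms by simp
  moreover have "n = t * (n div t) + n mod t" by simp
  ultimately have "n \<le> 2 * t * (n div t)" by linarith
  then have "n ^ t \<le> (2 * t * (n div t)) ^ t" by (rule power_mono) simp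
  then show ?thesis
    using binomial_le_pow[OF assms(2)] by (simp add: power_mult_distrib)
qed

theorem theorem21:
  fixes s t :: nat
  assumes "s > t" and "t \<ge> 2"
  shows "\<exists>c::real. c > 0 \<and>
    (\<forall>\<^sub>F n in sequentially.
       real (min_crossing_edges n (n - s) (n - t)) \<le> (1 - c) * real (n choose t))"
proof -
  define c :: real where "c = 1 / real ((2 * t) ^ t)"
  have pos: "0 < real ((2 * t) ^ t)" using assms by simp
  have "real (min_crossing_edges n (n - s) (n - t)) \<le> (1 - c) * real (n choose t)"
    if "s \<le> n" for n
  proof -
    have "(\<lambda>x. x mod t) ` {..<n} \<subseteq> {..<t}" using assms by auto
    then have "card ((\<lambda>x. x mod t) ` {..<n}) \<le> t"
      using card_mono[of "{..<t}"] by fastforce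
    then have "min_crossing_edges n (n - s) (n - t) + (n div t) ^ t \<le> n choose t"
      using min_crossing_edges_plus_rainbow_le[of "\<lambda>x. x mod t" n t s]
        card_rainbow_mod_ge[of n t] assms that by linarith
    then have "real (min_crossing_edges n (n - s) (n - t)) + real ((n div t) ^ t)
        \<le> real (n choose t)"
      by (metis of_nat_add of_nat_le_iff)
    moreover have "c * real (n choose t) \<le> real ((n div t) ^ t)"
    proof -
      have "n choose t \<le> (2 * t) ^ t * (n div t) ^ t"
        using assms that by (intro binomial_le_div_power) auto
      then have "real (n choose t) \<le> real ((2 * t) ^ t) * real ((n div t) ^ t)"
        by (metis of_nat_le_iff of_nat_mult)
      then show ?thesis using pos unfolding c_def by (simp add: field_simps)
    qed
    ultimately show ?thesis by (simp add: algebra_simps)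
  qed
  moreover have "c > 0" using pos by (simp add: c_def)
  ultimately show ?thesis
    by (intro exI[of _ c] conjI eventually_sequentiallyI[of s]) auto
qed

end
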